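(* Let $D$ be an integrally closed domain with quotient field $K$, let $n\geq 1$, and let $S\subseteq M_n(K)$. Then $\mathrm{Int}_K(S,S')=\mathrm{Int}_K(\Omega_S,\Lambda_n)$, and in particular $\mathrm{Int}_K(S,S')$ is integrally closed (in its quotient field).
   Context: $\overline{K}$ is a fixed algebraic closure of $K$; $K$ is identified with the scalar matrices in $M_n(K)$. A matrix $M\in M_n(K)$ is integral (over $D$) if it is a root of a monic polynomial in $D[X]$. $K[S]$ is the $K$-subalgebra of $M_n(K)$ generated by $K$ and the elements of $S$; $S'=\{M\in K[S]\mid M\text{ is integral}\}$; $\mathrm{Int}_K(S,S')=\{f\in K[X]\mid f(M)\in S'\text{ for all }M\in S\}$. For $M\in M_n(K)$, $\Omega_M$ is the set of eigenvalues of $M$ in $\overline{K}$ (the roots of its minimal polynomial), and $\Omega_S=\bigcup_{M\in S}\Omega_M$. $\Lambda_n=\{\alpha\in\overline{K}\mid\alpha\text{ is a root of a monic polynomial in }D[X]\text{ of degree }n\}$, and for $\mathcal{E}\subseteq\overline{K}$, $\mathrm{Int}_K(\mathcal{E},\Lambda_n)=\{f\in K[X]\mid f(\mathcal{E})\subseteq\Lambda_n\}$. *)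

theory Defs
  imports
    "HOL-Computational_Algebra.Computational_Algebra"
    "HOL-Algebra.Algebraic_Closure_Type"
    "Jordan_Normal_Form.Char_Poly"
begin

definition is_subring :: "'a::comm_ring_1 set \<Rightarrow> bool" where
  "is_subring R \<longleftrightarrow> 1 \<in> R \<and> (\<forall>x\<in>R. \<forall>y\<in>R. x - y \<in> R \<and> x * y \<in> R)"

text \<open>The quotient field of a subring \<open>R\<close> of a field, formed inside that field.\<close>

definition quotient_field :: "'a::field set \<Rightarrow> 'a set" where
  "quotient_field R = {a / b | a b. a \<in> R \<and> b \<in> R \<and> b \<noteq> 0}"

definition monic_polys_over :: "'a::comm_ring_1 set \<Rightarrow> 'a poly set" where
  "monic_polys_over R = {p. lead_coeff p = 1 \<and> (\<forall>i. coeff p i \<in> R)}"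

definition integral_over :: "'a::comm_ring_1 set \<Rightarrow> 'a \<Rightarrow> bool" where
  "integral_over R x \<longleftrightarrow> (\<exists>p\<in>monic_polys_over R. poly p x = 0)"

text \<open>Integral closedness is relative to the quotient field of \<open>R\<close>, which may be smaller than
  the ambient field.\<close>

definition integrally_closed_domain :: "'a::field set \<Rightarrow> bool" where
  "integrally_closed_domain R \<longleftrightarrow>
     is_subring R \<and> (\<forall>x\<in>quotient_field R. integral_over R x \<longrightarrow> x \<in> R)"

text \<open>The value \<open>f(M)\<close>, for a square matrix \<open>M\<close>; note that \<open>M ^\<^sub>m 0\<close> is the identity matrix.\<close>

definition poly_mat :: "'a::comm_ring_1 poly \<Rightarrow> 'a mat \<Rightarrow> 'a mat" where
  "poly_mat f M = mat (dim_row M) (dim_row M)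
     (\<lambda>ij. \<Sum>k\<le>degree f. coeff f k * (M ^\<^sub>m k) $$ ij)"

definition mat_integral_over :: "'a::comm_ring_1 set \<Rightarrow> 'a mat \<Rightarrow> bool" where
  "mat_integral_over D M \<longleftrightarrow>
     (\<exists>p\<in>monic_polys_over D. poly_mat p M = 0\<^sub>m (dim_row M) (dim_row M))"

text \<open>The subalgebra \<open>K[S]\<close> of \<open>M\<^sub>n(K)\<close>. Closure under negation and under multiplication by
  scalars follows from the scalar matrices being included.\<close>

inductive_set gen_algebra :: "nat \<Rightarrow> 'a::comm_ring_1 mat set \<Rightarrow> 'a mat set"
  for n :: nat and S :: "'a mat set" where
  scalar: "c \<cdot>\<^sub>m 1\<^sub>m n \<in> gen_algebra n S"
| gen: "M \<in> S \<Longrightarrow> M \<in> gen_algebra n S"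
| add: "A \<in> gen_algebra n S \<Longrightarrow> B \<in> gen_algebra n S \<Longrightarrow> A + B \<in> gen_algebra n S"
| mult: "A \<in> gen_algebra n S \<Longrightarrow> B \<in> gen_algebra n S \<Longrightarrow> A * B \<in> gen_algebra n S"

text \<open>The set \<open>S'\<close> of integral elements of \<open>K[S]\<close>.\<close>

definition integral_elements :: "'a::comm_ring_1 set \<Rightarrow> nat \<Rightarrow> 'a mat set \<Rightarrow> 'a mat set" where
  "integral_elements D n S = {M \<in> gen_algebra n S. mat_integral_over D M}"

text \<open>\<open>Int\<^sub>K(S, T)\<close> for sets of matrices.\<close>

definition Int_mat :: "'a::comm_ring_1 mat set \<Rightarrow> 'a mat set \<Rightarrow> 'a poly set" where
  "Int_mat S T = {f. \<forall>M\<in>S. poly_mat f M \<in> T}"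

text \<open>\<open>Int\<^sub>K(E, F)\<close> for subsets of the algebraic closure of \<open>K\<close>; polynomials over \<open>K\<close> are
  evaluated there through the embedding \<^const>\<open>to_ac\<close>.\<close>

definition Int_ac :: "'a::field alg_closure set \<Rightarrow> 'a alg_closure set \<Rightarrow> 'a poly set" where
  "Int_ac E F = {f. \<forall>\<alpha>\<in>E. poly (map_poly to_ac f) \<alpha> \<in> F}"

definition Omega_mat :: "'a::field mat \<Rightarrow> 'a alg_closure set" where
  "Omega_mat M = {\<alpha>. eigenvalue (map_mat to_ac M) \<alpha>}"

definition Omega :: "'a::field mat set \<Rightarrow> 'a alg_closure set" where
  "Omega S = (\<Union>M\<in>S. Omega_mat M)"

definition Lambda :: "'a::field set \<Rightarrow> nat \<Rightarrow> 'a alg_closure set" where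
  "Lambda D n = {\<alpha>. \<exists>p\<in>monic_polys_over D. degree p = n \<and> poly (map_poly to_ac p) \<alpha> = 0}"

end

theory Submission
  imports Defs
begin

text \<open>For \<open>M \<in> S\<close>, the eigenvalues of \<open>f(M)\<close> are the values of \<open>f\<close> on \<open>\<Omega>\<^sub>M\<close>. If these
  are integral over \<open>D\<close>, then so are the coefficients of the characteristic polynomial of \<open>f(M)\<close>;
  they lie in \<open>K\<close>, hence in \<open>D\<close>. This polynomial is monic of degree \<open>n\<close>, vanishes at the values of
  \<open>f\<close> on \<open>\<Omega>\<^sub>M\<close>, and, by Cayley--Hamilton, at \<open>f(M)\<close>. So both rings of polynomials consist of the \<open>f\<close>
  whose values on \<open>\<Omega>\<^sub>S\<close> are integral over \<open>D\<close>. An element of \<open>K(X)\<close> that is integral over this ring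
  lies in \<open>K[X]\<close>, and evaluating its integral equation shows that its values on \<open>\<Omega>\<^sub>S\<close> are again
  integral over \<open>D\<close>.\<close>

section \<open>Integral closure\<close>

lemma is_subring_one: "is_subring R \<Longrightarrow> 1 \<in> R"
  by (simp add: is_subring_def)

lemma is_subring_diff: "is_subring R \<Longrightarrow> x \<in> R \<Longrightarrow> y \<in> R \<Longrightarrow> x - y \<in> R"
  by (simp add: is_subring_def)

lemma is_subring_mult: "is_subring R \<Longrightarrow> x \<in> R \<Longrightarrow> y \<in> R \<Longrightarrow> x * y \<in> R"
  by (simp add: is_subring_def)

lemma is_subring_zero: "is_subring R \<Longrightarrow> 0 \<in> R"
  using is_subring_diff[of R 1 1] is_subring_one[of R] by simp

lemma is_subring_uminus: "is_subring R \<Longrightarrow> x \<in> R \<Longrightarrow> - x \<in> R"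
  using is_subring_diff[of R 0 x] is_subring_zero[of R] by simp

lemma is_subring_add: "is_subring R \<Longrightarrow> x \<in> R \<Longrightarrow> y \<in> R \<Longrightarrow> x + y \<in> R"
  using is_subring_diff[of R x "- y"] is_subring_uminus[of R y] by simp

lemma is_subring_power: "is_subring R \<Longrightarrow> x \<in> R \<Longrightarrow> x ^ k \<in> R"
  by (induction k) (auto intro: is_subring_one is_subring_mult)

lemma is_subring_sum: "is_subring R \<Longrightarrow> (\<And>i. i \<in> I \<Longrightarrow> f i \<in> R) \<Longrightarrow> sum f I \<in> R"
  by (induction I rule: infinite_finite_induct) (auto intro: is_subring_zero is_subring_add)

lemma is_subring_prod: "is_subring R \<Longrightarrow> (\<And>i. i \<in> I \<Longrightarrow> f i \<in> R) \<Longrightarrow> prod f I \<in> R"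
  by (induction I rule: infinite_finite_induct) (auto intro: is_subring_one is_subring_mult)

lemmas is_subring_intros = is_subring_one is_subring_zero is_subring_diff is_subring_uminus
  is_subring_add is_subring_mult is_subring_power is_subring_sum is_subring_prod

lemma is_subring_hom_image:
  assumes "comm_ring_hom h" and "is_subring R"
  shows "is_subring (h ` R)"
proof -
  interpret comm_ring_hom h by fact
  show ?thesis
    using assms(2) unfolding is_subring_def
    by (auto simp flip: hom_minus hom_mult) (metis hom_one imageI)
qed

lemma is_subring_polys: "is_subring R \<Longrightarrow> is_subring {p. \<forall>i. coeff p i \<in> R}"
  unfolding is_subring_def[of "Collect _"]
  by (auto simp: coeff_mult coeff_pCons one_pCons split: nat.splits intro!: is_subring_intros)

section \<open>Determinants and characteristic polynomials over a subring\<close>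

lemma det_in_subring:
  assumes "is_subring R" and A: "A \<in> carrier_mat n n"
    and "\<And>i j. i < n \<Longrightarrow> j < n \<Longrightarrow> A $$ (i, j) \<in> R"
  shows "det A \<in> R"
proof -
  have "signof p \<in> R" for p
    using assms(1) by (auto simp: sign_def intro: is_subring_intros)
  then show ?thesis
    unfolding det_def'[OF A] using assms
    by (intro is_subring_sum is_subring_mult is_subring_prod)
      (auto dest: permutes_in_image simp: atLeast0LessThan)
qed

text \<open>The entries of the characteristic matrix lie in the ring of polynomials with
  coefficients in \<open>R\<close>, and the Leibniz expansion of the determinant does not leave that
  ring.\<close>

lemma char_poly_monic_polys_over:
  fixes A :: "'a::idom mat"
  assumes R: "is_subring R" and A: "A \<in> carrier_mat n n"
    and "\<And>i j. i < n \<Longrightarrow> j < n \<Longrightarrow> A $$ (i, j) \<in> R"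
  shows "char_poly A \<in> monic_polys_over R"
proof -
  have "char_poly_matrix A $$ (i, j) \<in> {p. \<forall>k. coeff p k \<in> R}" if "i < n" "j < n" for i j
    using assms that unfolding char_poly_matrix_def
    by (auto simp: coeff_pCons split: nat.splits intro: is_subring_intros)
  then have "char_poly A \<in> {p. \<forall>k. coeff p k \<in> R}"
    unfolding char_poly_def using A by (intro det_in_subring[of _ _ n] is_subring_polys R) auto
  then show ?thesis
    using degree_monic_char_poly[OF A] by (simp add: monic_polys_over_def)
qed

section \<open>Finitely generated modules over a subring\<close>

definition lin_span :: "'a::comm_ring_1 set \<Rightarrow> 'a set \<Rightarrow> 'a set" where
  "lin_span R V = {\<Sum>v\<in>V. r v * v | r. \<forall>v\<in>V. r v \<in> R}"

lemma lin_span_zero: "is_subring R \<Longrightarrow> 0 \<in> lin_span R V"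
  unfolding lin_span_def by (auto intro!: exI[of _ "\<lambda>_. 0"] is_subring_zero)

lemma lin_span_add:
  assumes "is_subring R" "x \<in> lin_span R V" "y \<in> lin_span R V"
  shows "x + y \<in> lin_span R V"
proof -
  from assms obtain r s where "\<forall>v\<in>V. r v \<in> R" "\<forall>v\<in>V. s v \<in> R"
    "x = (\<Sum>v\<in>V. r v * v)" "y = (\<Sum>v\<in>V. s v * v)"
    unfolding lin_span_def by blast
  with assms(1) show ?thesis
    unfolding lin_span_def
    by (auto simp: sum.distrib algebra_simps intro!: exI[of _ "\<lambda>v. r v + s v"] is_subring_add)
qed

lemma lin_span_scale:
  assumes "is_subring R" "c \<in> R" "x \<in> lin_span R V"
  shows "c * x \<in> lin_span R V"
proof -
  from assms obtain r where "\<forall>v\<in>V. r v \<in> R" "x = (\<Sum>v\<in>V. r v * v)"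
    unfolding lin_span_def by blast
  with assms(1,2) show ?thesis
    unfolding lin_span_def
    by (auto simp: sum_distrib_left algebra_simps intro!: exI[of _ "\<lambda>v. c * r v"] is_subring_mult)
qed

lemma lin_span_sum:
  "is_subring R \<Longrightarrow> (\<And>i. i \<in> I \<Longrightarrow> f i \<in> lin_span R V) \<Longrightarrow> sum f I \<in> lin_span R V"
  by (induction I rule: infinite_finite_induct) (auto intro: lin_span_zero lin_span_add)

lemma lin_span_base:
  assumes "is_subring R" "finite V" "v \<in> V"
  shows "v \<in> lin_span R V"
proof -
  have "v = (\<Sum>u\<in>V. (if u = v then 1 else 0) * u)"
    using assms by (simp add: if_distrib[of "\<lambda>c. c * _"] cong: if_cong)
  then show ?thesis
    unfolding lin_span_def using assms(1)
    by (auto intro!: exI[of _ "\<lambda>u. if u = v then 1 else 0"] is_subring_zero is_subring_one)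
qed

text \<open>For a ring \<open>T\<close> containing \<open>R\<close> this is finite generation as an
  \<open>R\<close>-module: since the generators lie in \<open>T\<close>, so does their span.\<close>

definition finite_over :: "'a::comm_ring_1 set \<Rightarrow> 'a set \<Rightarrow> bool" where
  "finite_over R T \<longleftrightarrow> (\<exists>V. finite V \<and> V \<subseteq> T \<and> T \<subseteq> lin_span R V)"

lemma finite_over_refl:
  assumes "is_subring R"
  shows "finite_over R R"
proof -
  have "r \<in> lin_span R {1}" if "r \<in> R" for r
    unfolding lin_span_def using that by (auto intro!: exI[of _ "\<lambda>_. r"])
  with assms show ?thesis
    unfolding finite_over_def by (auto intro!: exI[of _ "{1}"] is_subring_one)
qed

text \<open>Tower law: products of generators of \<open>T\<close> over \<open>R\<close> with
  generators of \<open>U\<close> over \<open>T\<close> generate \<open>U\<close> over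
  \<open>R\<close>.\<close>

lemma finite_over_trans:
  assumes "is_subring R" "is_subring U" "T \<subseteq> U" "finite_over R T" "finite_over T U"
  shows "finite_over R U"
proof -
  obtain V where V: "finite V" "V \<subseteq> T" "T \<subseteq> lin_span R V"
    using assms(4) unfolding finite_over_def by blast
  obtain W where W: "finite W" "W \<subseteq> U" "U \<subseteq> lin_span T W"
    using assms(5) unfolding finite_over_def by blast
  let ?P = "(\<lambda>(v, w). v * w) ` (V \<times> W)"
  have fin: "finite ?P"
    using V(1) W(1) by simp
  \<comment> \<open>Distinct pairs may have the same product, so membership in the span is built up
    from single products instead of reindexing a double sum.\<close>
  have scaled: "t * w \<in> lin_span R ?P" if tw: "t \<in> T" "w \<in> W" for t w
  proof -
    obtain r where r: "\<forall>v\<in>V. r v \<in> R" "t = (\<Sum>v\<in>V. r v * v)"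
      using V(3) tw(1) unfolding lin_span_def by blast
    have "t * w = (\<Sum>v\<in>V. r v * (v * w))"
      by (simp add: r(2) sum_distrib_right mult.assoc)
    also have "\<dots> \<in> lin_span R ?P"
      using r(1) tw(2) by (intro lin_span_sum lin_span_scale lin_span_base assms(1) fin) auto
    finally show ?thesis .
  qed
  have "U \<subseteq> lin_span R ?P"
  proof
    fix u assume "u \<in> U"
    then obtain t where "\<forall>w\<in>W. t w \<in> T" "u = (\<Sum>w\<in>W. t w * w)"
      using W(3) unfolding lin_span_def by blast
    then show "u \<in> lin_span R ?P"
      using scaled by (auto intro!: lin_span_sum assms(1))
  qed
  moreover have "?P \<subseteq> U"
    using V(2) W(2) assms(2,3) by (auto intro: is_subring_mult)
  ultimately show ?thesis
    using fin unfolding finite_over_def by blast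
qed

text \<open>The determinant trick: multiplication by an element of \<open>T\<close> acts on a finite generating family
  through a matrix over \<open>R\<close>, and the family is an eigenvector of that matrix.\<close>

lemma finite_over_imp_integral_over:
  fixes R :: "'a::field set"
  assumes R: "is_subring R" and T: "is_subring T" and "finite_over R T" and "x \<in> T"
  shows "integral_over R x"
proof -
  obtain V where V: "finite V" "V \<subseteq> T" "T \<subseteq> lin_span R V"
    using \<open>finite_over R T\<close> unfolding finite_over_def by blast
  obtain vs where vs: "set vs = V" "distinct vs"
    using finite_distinct_list[OF V(1)] by blast
  define n where "n = length vs"
  have sum_V: "(\<Sum>v\<in>V. g v) = (\<Sum>j<n. g (vs ! j))" for g :: "'a \<Rightarrow> 'a"
    using sum.reindex_bij_betw[OF bij_betw_nth[OF vs(2) _ vs(1)[symmetric]], of "{..<n}" g]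
    by (simp add: n_def)
  have "\<exists>r. (\<forall>v\<in>V. r v \<in> R) \<and> x * vs ! i = (\<Sum>v\<in>V. r v * v)" if "i < n" for i
  proof -
    have "x * vs ! i \<in> T"
      using that V(2) vs(1) assms(4) by (intro is_subring_mult[OF T]) (auto simp: n_def)
    then show ?thesis
      using V(3) unfolding lin_span_def by blast
  qed
  then obtain r where r: "\<And>i v. i < n \<Longrightarrow> v \<in> V \<Longrightarrow> r i v \<in> R"
    "\<And>i. i < n \<Longrightarrow> x * vs ! i = (\<Sum>v\<in>V. r i v * v)"
    by metis
  define A where "A = mat n n (\<lambda>(i, j). r i (vs ! j))"
  define w where "w = vec n (\<lambda>j. vs ! j)"
  have A: "A \<in> carrier_mat n n"
    by (simp add: A_def)
  \<comment> \<open>If all generators vanished, or if there were none, the expression of 1 through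
    them would give 1 = 0.\<close>
  have "w \<noteq> 0\<^sub>v n"
  proof
    assume w0: "w = 0\<^sub>v n"
    have "vs ! j = 0" if "j < n" for j
      using arg_cong[OF w0, of "\<lambda>v. vec_index v j"] that by (simp add: w_def)
    moreover obtain s where "1 = (\<Sum>v\<in>V. s v * v)"
      using V(3) is_subring_one[OF T] unfolding lin_span_def by blast
    ultimately show False
      by (simp add: sum_V)
  qed
  moreover have "A *\<^sub>v w = x \<cdot>\<^sub>v w"
    by (rule eq_vecI)
      (auto simp: A_def w_def scalar_prod_def r(2) sum_V atLeast0LessThan)
  ultimately have "eigenvalue A x"
    using A unfolding eigenvalue_def eigenvector_def by (intro exI[of _ w]) (auto simp: w_def)
  then have "poly (char_poly A) x = 0"
    using eigenvalue_root_char_poly[OF A] by blast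
  moreover have "char_poly A \<in> monic_polys_over R"
    using r(1) vs(1) by (intro char_poly_monic_polys_over[OF R A]) (auto simp: A_def n_def)
  ultimately show ?thesis
    unfolding integral_over_def by blast
qed

section \<open>Adjoining integral elements\<close>

definition adjoin :: "'a::comm_ring_1 set \<Rightarrow> 'a \<Rightarrow> 'a set" where
  "adjoin T x = (\<lambda>p. poly p x) ` {p. \<forall>i. coeff p i \<in> T}"

text \<open>Evaluation at \<open>x\<close> is a ring homomorphism, and \<open>adjoin T x\<close> is
  its image of the subring of polynomials over \<open>T\<close>.\<close>

lemma is_subring_adjoin:
  assumes "is_subring T"
  shows "is_subring (adjoin T x)"
  unfolding adjoin_def
  by (intro is_subring_hom_image is_subring_polys assms) (unfold_locales, auto)

lemma subset_adjoin:
  assumes "is_subring T"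
  shows "T \<subseteq> adjoin T x"
proof
  fix t assume "t \<in> T"
  then have "\<forall>i. coeff [:t:] i \<in> T"
    using is_subring_zero[OF assms] by (auto simp: coeff_pCons split: nat.splits)
  then show "t \<in> adjoin T x"
    unfolding adjoin_def by (auto intro!: image_eqI[of _ _ "[:t:]"])
qed

lemma mem_adjoin:
  assumes "is_subring T"
  shows "x \<in> adjoin T x"
proof -
  have "\<forall>i. coeff [:0, 1:] i \<in> T"
    using assms by (auto simp: coeff_pCons split: nat.splits intro: is_subring_intros)
  then show ?thesis
    unfolding adjoin_def by (auto intro!: image_eqI[of _ _ "[:0, 1:]"])
qed

text \<open>The powers of \<open>x\<close> below the degree of a monic relation generate: the
  relation rewrites the next power, so multiplication by \<open>x\<close> preserves their
  span.\<close>

lemma finite_over_adjoin: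
  assumes T: "is_subring T" and "integral_over T x"
  shows "finite_over T (adjoin T x)"
proof -
  obtain q where q: "lead_coeff q = 1" "\<And>i. coeff q i \<in> T" "poly q x = 0"
    using \<open>integral_over T x\<close> unfolding integral_over_def monic_polys_over_def by auto
  define V where "V = (\<lambda>i. x ^ i) ` {..<degree q}"
  have fin: "finite V"
    by (simp add: V_def)
  have small: "x ^ i \<in> lin_span T V" if "i < degree q" for i
    using that by (intro lin_span_base T fin) (simp add: V_def)
  have top: "x ^ degree q \<in> lin_span T V"
  proof -
    have "x ^ degree q = (\<Sum>i<degree q. (- coeff q i) * x ^ i)"
      using q(1,3)
      by (simp add: poly_altdef lessThan_Suc_atMost[symmetric] sum_negf eq_neg_iff_add_eq_0 add.commute)
    also have "\<dots> \<in> lin_span T V"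
      using small q(2) by (intro lin_span_sum lin_span_scale is_subring_uminus T) auto
    finally show ?thesis .
  qed
  have step: "x * y \<in> lin_span T V" if y: "y \<in> lin_span T V" for y
  proof -
    obtain r where r: "\<forall>v\<in>V. r v \<in> T" "y = (\<Sum>v\<in>V. r v * v)"
      using y unfolding lin_span_def by blast
    have "x * y = (\<Sum>v\<in>V. r v * (x * v))"
      by (simp add: r(2) sum_distrib_left mult.left_commute)
    also have "\<dots> \<in> lin_span T V"
    proof (rule lin_span_sum[OF T], rule lin_span_scale[OF T])
      fix v assume v: "v \<in> V"
      then show "r v \<in> T" using r(1) by blast
      from v obtain i where "i < degree q" "v = x ^ i"
        by (auto simp: V_def)
      then show "x * v \<in> lin_span T V"
        using small[of "Suc i"] top by (cases "Suc i = degree q") (auto simp flip: power_Suc)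
    qed
    finally show ?thesis .
  qed
  have powers: "x ^ k \<in> lin_span T V" for k
  proof (induction k)
    case 0
    \<comment> \<open>If \<open>degree q = 0\<close>, then the power 0 is itself the top
      power.\<close>
    show ?case using small[of 0] top by (cases "degree q = 0") auto
  qed (use step in simp)
  have "adjoin T x \<subseteq> lin_span T V"
    unfolding adjoin_def poly_altdef using powers by (auto intro!: lin_span_sum lin_span_scale T)
  moreover have "V \<subseteq> adjoin T x"
    using is_subring_power[OF is_subring_adjoin[OF T] mem_adjoin[OF T]] by (auto simp: V_def)
  ultimately show ?thesis
    using fin unfolding finite_over_def by blast
qed

lemma integral_over_mono: "R \<subseteq> T \<Longrightarrow> integral_over R x \<Longrightarrow> integral_over T x"
  unfolding integral_over_def monic_polys_over_def by blast

text \<open>Adjoin the elements of \<open>C\<close> one at a time: each is integral over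
  \<open>R\<close>, hence over the ring built so far, and finiteness passes through the
  tower.\<close>

lemma finite_over_integral_extension:
  assumes R: "is_subring R" and "finite C" and "\<And>c. c \<in> C \<Longrightarrow> integral_over R c"
  shows "\<exists>T. is_subring T \<and> R \<subseteq> T \<and> C \<subseteq> T \<and> finite_over R T"
  using assms(2,3)
proof (induction C)
  case empty
  then show ?case using R finite_over_refl by blast
next
  case (insert c C)
  then obtain T where T: "is_subring T" "R \<subseteq> T" "C \<subseteq> T" "finite_over R T"
    by auto
  have "finite_over T (adjoin T c)"
    using insert.prems integral_over_mono[OF T(2)] by (intro finite_over_adjoin T) auto
  then have "finite_over R (adjoin T c)"
    by (rule finite_over_trans[OF R is_subring_adjoin[OF T(1)] subset_adjoin[OF T(1)] T(4)])
  then show ?case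
    using T is_subring_adjoin[OF T(1)] subset_adjoin[OF T(1)] mem_adjoin[OF T(1)]
    by (intro exI[of _ "adjoin T c"]) blast
qed

lemma integral_over_base:
  assumes "is_subring R" "x \<in> R"
  shows "integral_over R x"
proof -
  have "[:- x, 1:] \<in> monic_polys_over R"
    using assms unfolding monic_polys_over_def
    by (auto simp: coeff_pCons split: nat.splits intro: is_subring_intros)
  then show ?thesis
    unfolding integral_over_def by (auto intro!: bexI[of _ "[:- x, 1:]"])
qed

text \<open>Differences and products of \<open>x\<close> and \<open>y\<close> stay in one ring that
  is finite over \<open>R\<close> and contains both, where the determinant trick applies.\<close>

lemma is_subring_integral_closure:
  fixes R :: "'a::field set"
  assumes R: "is_subring R"
  shows "is_subring {x. integral_over R x}"
proof -
  have "integral_over R (x - y) \<and> integral_over R (x * y)"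
    if xy: "integral_over R x" "integral_over R y" for x y
  proof -
    obtain T where T: "is_subring T" "R \<subseteq> T" "{x, y} \<subseteq> T" "finite_over R T"
      using finite_over_integral_extension[OF R, of "{x, y}"] xy by auto
    then show ?thesis
      by (auto intro!: finite_over_imp_integral_over[OF R T(1,4)] is_subring_intros)
  qed
  then show ?thesis
    unfolding is_subring_def[of "Collect _"] using R
    by (auto intro: integral_over_base is_subring_one)
qed

text \<open>An equation for \<open>y\<close> involves finitely many coefficients. Adjoining these
  and then \<open>y\<close> gives a ring still finite over \<open>R\<close>.\<close>

lemma integral_over_trans:
  fixes R :: "'a::field set"
  assumes R: "is_subring R" and "integral_over {x. integral_over R x} y"
  shows "integral_over R y"
proof -
  obtain q where q: "lead_coeff q = 1" "\<And>i. integral_over R (coeff q i)" "poly q y = 0"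
    using assms(2) unfolding integral_over_def[of "Collect _"] monic_polys_over_def by auto
  obtain T where T: "is_subring T" "R \<subseteq> T" "coeff q ` {..degree q} \<subseteq> T" "finite_over R T"
    using finite_over_integral_extension[OF R, of "coeff q ` {..degree q}"] q(2) by auto
  have "coeff q i \<in> T" for i
    using T(1,3) by (cases "i \<le> degree q") (auto simp: coeff_eq_0 intro: is_subring_zero)
  then have "integral_over T y"
    using q unfolding integral_over_def monic_polys_over_def by blast
  then have "finite_over R (adjoin T y)"
    by (intro finite_over_trans[OF R is_subring_adjoin[OF T(1)] subset_adjoin[OF T(1)] T(4)]
      finite_over_adjoin T(1))
  then show ?thesis
    by (rule finite_over_imp_integral_over[OF R is_subring_adjoin[OF T(1)] _ mem_adjoin[OF T(1)]])
qed

section \<open>Polynomials in a matrix\<close>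

lemma poly_mat_carrier [simp]: "M \<in> carrier_mat n n \<Longrightarrow> poly_mat f M \<in> carrier_mat n n"
  by (simp add: poly_mat_def)

lemma dim_poly_mat [simp]:
  "dim_row (poly_mat f M) = dim_row M" "dim_col (poly_mat f M) = dim_row M"
  by (simp_all add: poly_mat_def)

text \<open>A free bound \<open>N\<close> gives polynomials of different degrees a common range of
  summation.\<close>

lemma index_poly_mat:
  assumes "M \<in> carrier_mat n n" "i < n" "j < n" "degree f \<le> N"
  shows "poly_mat f M $$ (i, j) = (\<Sum>k\<le>N. coeff f k * (M ^\<^sub>m k) $$ (i, j))"
proof -
  have "(\<Sum>k\<le>degree f. coeff f k * (M ^\<^sub>m k) $$ (i, j)) = (\<Sum>k\<le>N. coeff f k * (M ^\<^sub>m k) $$ (i, j))"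
    using assms(4) by (intro sum.mono_neutral_left) (auto simp: coeff_eq_0)
  then show ?thesis
    using assms by (simp add: poly_mat_def)
qed

lemma poly_mat_0: "M \<in> carrier_mat n n \<Longrightarrow> poly_mat 0 M = 0\<^sub>m n n"
  by (intro eq_matI) (auto simp: poly_mat_def)

text \<open>Horner's rule, which drives the later inductions over polynomials.\<close>

lemma poly_mat_pCons:
  assumes M: "M \<in> carrier_mat n n"
  shows "poly_mat (pCons a f) M = a \<cdot>\<^sub>m 1\<^sub>m n + poly_mat f M * M"
proof (rule eq_matI)
  fix i j
  assume "i < dim_row (a \<cdot>\<^sub>m 1\<^sub>m n + poly_mat f M * M)"
    "j < dim_col (a \<cdot>\<^sub>m 1\<^sub>m n + poly_mat f M * M)"
  then have ij: "i < n" "j < n"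
    using M by auto
  have "(poly_mat f M * M) $$ (i, j) =
      (\<Sum>l<n. \<Sum>k\<le>degree f. coeff f k * (M ^\<^sub>m k) $$ (i, l) * M $$ (l, j))"
    using M ij
    by (simp add: scalar_prod_def index_poly_mat[OF M _ _ order_refl] sum_distrib_right
        atLeast0LessThan)
  also have "\<dots> = (\<Sum>k\<le>degree f. \<Sum>l<n. coeff f k * (M ^\<^sub>m k) $$ (i, l) * M $$ (l, j))"
    by (rule sum.swap)
  also have "\<dots> = (\<Sum>k\<le>degree f. coeff f k * (M ^\<^sub>m Suc k) $$ (i, j))"
    using M ij by (intro sum.cong refl)
      (simp add: scalar_prod_def sum_distrib_left mult.assoc atLeast0LessThan)
  finally show "poly_mat (pCons a f) M $$ (i, j) = (a \<cdot>\<^sub>m 1\<^sub>m n + poly_mat f M * M) $$ (i, j)"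
    using M ij index_poly_mat[OF M ij, of "pCons a f" "Suc (degree f)"]
    by (simp add: sum.atMost_Suc_shift degree_pCons_le
        del: pow_mat.simps(2) sum.atMost_Suc index_mult_mat(1))
qed (use M in auto)

lemma poly_mat_add:
  assumes M: "M \<in> carrier_mat n n"
  shows "poly_mat (f + g) M = poly_mat f M + poly_mat g M"
proof (rule eq_matI)
  fix i j assume "i < dim_row (poly_mat f M + poly_mat g M)" "j < dim_col (poly_mat f M + poly_mat g M)"
  then have ij: "i < n" "j < n"
    using M by auto
  let ?N = "max (degree f) (degree g)"
  show "poly_mat (f + g) M $$ (i, j) = (poly_mat f M + poly_mat g M) $$ (i, j)"
    using M ij
    by (simp add: index_poly_mat[OF M ij, where N = ?N] degree_add_le sum.distrib algebra_simps)
qed (use M in auto)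

lemma poly_mat_smult:
  assumes M: "M \<in> carrier_mat n n"
  shows "poly_mat (smult c f) M = c \<cdot>\<^sub>m poly_mat f M"
proof (rule eq_matI)
  fix i j assume "i < dim_row (c \<cdot>\<^sub>m poly_mat f M)" "j < dim_col (c \<cdot>\<^sub>m poly_mat f M)"
  then have ij: "i < n" "j < n"
    using M by auto
  show "poly_mat (smult c f) M $$ (i, j) = (c \<cdot>\<^sub>m poly_mat f M) $$ (i, j)"
    using M ij
    by (simp add: index_poly_mat[OF M ij, where N = "degree f"] degree_smult_le sum_distrib_left mult.assoc)
qed (use M in auto)

lemma poly_mat_mult:
  assumes M: "M \<in> carrier_mat n n"
  shows "poly_mat (f * g) M = poly_mat f M * poly_mat g M"
proof (induction g)
  case 0
  show ?case using M by (simp add: poly_mat_0 right_mult_zero_mat[of _ n n])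
next
  case (pCons a g)
  have F: "poly_mat f M \<in> carrier_mat n n" and G: "poly_mat g M \<in> carrier_mat n n"
    using M by auto
  have "poly_mat (f * pCons a g) M = poly_mat (smult a f) M + poly_mat (pCons 0 (f * g)) M"
    by (simp add: poly_mat_add[OF M])
  also have "poly_mat (pCons 0 (f * g)) M = poly_mat f M * (poly_mat g M * M)"
    using M F G
    by (simp add: poly_mat_pCons[OF M] pCons.IH assoc_mult_mat[OF F G M] smult_mat_def one_mat_def)
      (rule eq_matI, auto)
  also have "poly_mat (smult a f) M = poly_mat f M * (a \<cdot>\<^sub>m 1\<^sub>m n)"
    using M F by (simp add: poly_mat_smult mult_smult_distrib[OF F one_carrier_mat])
  also have "poly_mat f M * (a \<cdot>\<^sub>m 1\<^sub>m n) + poly_mat f M * (poly_mat g M * M) =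
      poly_mat f M * poly_mat (pCons a g) M"
    using mult_add_distrib_mat[OF F smult_carrier_mat[OF one_carrier_mat] mult_carrier_mat[OF G M]]
    by (simp add: poly_mat_pCons[OF M])
  finally show ?case .
qed

lemma index_poly_mat_sum:
  assumes M: "M \<in> carrier_mat n n" and "i < n" "j < n"
  shows "poly_mat (sum f I) M $$ (i, j) = (\<Sum>k\<in>I. poly_mat (f k) M $$ (i, j))"
  using assms by (induction I rule: infinite_finite_induct) (auto simp: poly_mat_0 poly_mat_add)

lemma (in comm_ring_hom) map_mat_poly_mat:
  assumes M: "M \<in> carrier_mat n n"
  shows "map_mat hom (poly_mat f M) = poly_mat (map_poly hom f) (map_mat hom M)"
proof (rule eq_matI)
  fix i j
  assume "i < dim_row (poly_mat (map_poly hom f) (map_mat hom M))"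
    "j < dim_col (poly_mat (map_poly hom f) (map_mat hom M))"
  then have ij: "i < n" "j < n"
    using M by auto
  have hM: "map_mat hom M \<in> carrier_mat n n"
    using M by simp
  \<comment> \<open>Applying \<open>hom\<close> may lower the degree, so both sides are expanded up
    to \<open>degree f\<close>.\<close>
  show "map_mat hom (poly_mat f M) $$ (i, j) = poly_mat (map_poly hom f) (map_mat hom M) $$ (i, j)"
    using M ij index_poly_mat[OF M ij order_refl, of f]
      index_poly_mat[OF hM ij degree_map_poly_le, of hom f]
    by (simp add: hom_sum hom_mult flip: mat_hom_pow[OF M])
qed (use M in auto)

lemma poly_mat_gen_algebra:
  assumes "M \<in> carrier_mat n n" "M \<in> gen_algebra n S"
  shows "poly_mat f M \<in> gen_algebra n S"
proof (induction f)
  case 0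
  have "(0 :: 'a) \<cdot>\<^sub>m 1\<^sub>m n = 0\<^sub>m n n"
    by (intro eq_matI) auto
  then show ?case
    using gen_algebra.scalar[of 0 n S] assms(1) by (simp add: poly_mat_0)
qed (auto simp: poly_mat_pCons[OF assms(1)] intro: gen_algebra.intros assms(2))

text \<open>With \<open>X\<close> acting as \<open>A\<close>, the columns of \<open>char_poly_matrix A\<close> annihilate the standard basis;
  multiplying by the adjugate shows that its determinant annihilates it as well.\<close>

theorem cayley_hamilton:
  fixes A :: "'a::comm_ring_1 mat"
  assumes A: "A \<in> carrier_mat n n"
  shows "poly_mat (char_poly A) A = 0\<^sub>m n n"
proof (rule eq_matI)
  fix s k assume "s < dim_row (0\<^sub>m n n :: 'a mat)" "k < dim_col (0\<^sub>m n n :: 'a mat)"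
  then have sk: "s < n" "k < n" by auto
  define C where "C = char_poly_matrix A"
  define B where "B = adj_mat C"
  have C: "C \<in> carrier_mat n n"
    using A by (simp add: C_def)
  have B: "B \<in> carrier_mat n n" and CB: "C * B = char_poly A \<cdot>\<^sub>m 1\<^sub>m n"
    using adj_mat[OF C] by (auto simp: B_def C_def char_poly_def)
  \<comment> \<open>This is the \<open>r\<close>-th entry of the sum of \<open>C_ij(A) e_i\<close>
    over \<open>i\<close>, which equals \<open>A e_j\<close> minus the sum of
    \<open>A_ij e_i\<close>.\<close>
  have columns: "(\<Sum>i<n. poly_mat (C $$ (i, j)) A $$ (r, i)) = 0" if "r < n" "j < n" for r j
  proof -
    have "poly_mat (C $$ (i, j)) A $$ (r, i) =
        (if i = j then A $$ (r, i) else 0) - (if i = r then A $$ (i, j) else 0)" if "i < n" for i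
    proof -
      have "C $$ (i, j) = [:- A $$ (i, j), if i = j then 1 else 0:]"
        using A that \<open>j < n\<close> by (auto simp: C_def char_poly_matrix_def)
      then show ?thesis
        using A that \<open>r < n\<close> \<open>j < n\<close>
        by (auto simp: poly_mat_pCons[OF A] poly_mat_0[OF A] left_add_zero_mat[of _ n n]
            left_mult_zero_mat[of A n n] right_add_zero_mat[of _ n n] mult_smult_assoc_mat[of _ n n _ n])
    qed
    then show ?thesis
      using that by (simp add: sum_subtractf)
  qed
  \<comment> \<open>As \<open>C * B\<close> is scalar, only the term with \<open>i = k\<close>
    survives.\<close>
  have "poly_mat (char_poly A) A $$ (s, k) =
      (\<Sum>i<n. poly_mat ((C * B) $$ (i, k)) A $$ (s, i))"
  proof -
    have "poly_mat ((C * B) $$ (i, k)) A $$ (s, i) =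
        (if i = k then poly_mat (char_poly A) A $$ (s, k) else 0)" if "i < n" for i
      using that sk A by (auto simp: CB poly_mat_0)
    then show ?thesis
      using sk by simp
  qed
  \<comment> \<open>The factors are exchanged so that the matrix from \<open>B\<close> stands on the
    left; the inner sum over \<open>i\<close> is then one of \<open>columns\<close>.\<close>
  also have "\<dots> = (\<Sum>i<n. \<Sum>j<n. poly_mat (B $$ (j, k) * C $$ (i, j)) A $$ (s, i))"
    using B C sk
    by (simp add: scalar_prod_def index_poly_mat_sum[OF A] atLeast0LessThan mult.commute)
  also have "\<dots> = (\<Sum>j<n. \<Sum>i<n. \<Sum>r<n.
      poly_mat (B $$ (j, k)) A $$ (s, r) * poly_mat (C $$ (i, j)) A $$ (r, i))"
    using A sk
    by (subst sum.swap) (simp add: poly_mat_mult[OF A] scalar_prod_def atLeast0LessThan)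
  also have "\<dots> = (\<Sum>j<n. \<Sum>r<n.
      poly_mat (B $$ (j, k)) A $$ (s, r) * (\<Sum>i<n. poly_mat (C $$ (i, j)) A $$ (r, i)))"
    unfolding sum_distrib_left by (intro sum.cong refl sum.swap)
  also have "\<dots> = 0"
    by (simp add: columns)
  finally show "poly_mat (char_poly A) A $$ (s, k) = 0\<^sub>m n n $$ (s, k)"
    using sk by simp
qed (use A in auto)

section \<open>Eigenvalues of polynomials in a matrix\<close>

lemma poly_mat_pCons_mult_vec:
  assumes A: "A \<in> carrier_mat n n" and v: "v \<in> carrier_vec n"
  shows "poly_mat (pCons a f) A *\<^sub>v v = a \<cdot>\<^sub>v v + poly_mat f A *\<^sub>v (A *\<^sub>v v)"
proof -
  have F: "poly_mat f A \<in> carrier_mat n n"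
    using A by simp
  have "(a \<cdot>\<^sub>m 1\<^sub>m n) *\<^sub>v v = a \<cdot>\<^sub>v v"
    using v by (intro eq_vecI) (auto simp: scalar_prod_def if_distrib if_distribR cong: if_cong)
  then show ?thesis
    using F A v
    by (simp add: poly_mat_pCons[OF A] assoc_mult_mat_vec[OF F A v]
        add_mult_distrib_mat_vec[OF _ mult_carrier_mat[OF F A] v])
qed

lemma poly_mat_0_mult_vec:
  "A \<in> carrier_mat n n \<Longrightarrow> v \<in> carrier_vec n \<Longrightarrow> poly_mat 0 A *\<^sub>v v = 0\<^sub>v n"
  by (auto simp: poly_mat_0)

lemma eigenvector_poly_mat:
  fixes A :: "'a::field mat"
  assumes A: "A \<in> carrier_mat n n" and v: "v \<in> carrier_vec n" and Av: "A *\<^sub>v v = \<alpha> \<cdot>\<^sub>v v"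
  shows "poly_mat f A *\<^sub>v v = poly f \<alpha> \<cdot>\<^sub>v v"
proof (induction f)
  case 0
  show ?case using v by (auto simp: poly_mat_0_mult_vec[OF A v])
next
  case (pCons a f)
  have "poly_mat f A *\<^sub>v (A *\<^sub>v v) = \<alpha> \<cdot>\<^sub>v (poly f \<alpha> \<cdot>\<^sub>v v)"
    using A v by (simp add: Av mult_mat_vec[of _ n n] pCons.IH)
  then show ?case
    by (simp add: poly_mat_pCons_mult_vec[OF A v] smult_smult_assoc add_smult_distrib_vec)
qed

text \<open>Split off a linear factor of \<open>g\<close> at a root \<gamma>. Either
  \<open>A\<close> minus \<gamma> kills \<open>v\<close>, which is then an eigenvector, or it sends
  \<open>v\<close> to a nonzero vector killed by the cofactor, of smaller degree.\<close>

lemma poly_mat_kernel_imp_eigenvalue: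
  fixes A :: "'a::alg_closed_field mat"
  assumes A: "A \<in> carrier_mat n n" and "g \<noteq> 0"
    and "v \<in> carrier_vec n" "v \<noteq> 0\<^sub>v n" "poly_mat g A *\<^sub>v v = 0\<^sub>v n"
  shows "\<exists>\<gamma>. poly g \<gamma> = 0 \<and> eigenvalue A \<gamma>"
  using assms(2-)
proof (induction "degree g" arbitrary: g v)
  case 0
  then obtain c where c: "g = [:c:]" "c \<noteq> 0"
    using degree_eq_zeroE by (metis pCons_0_0)
  have "c \<cdot>\<^sub>v v = 0\<^sub>v n"
    using 0 A by (simp add: c poly_mat_pCons_mult_vec[OF A] poly_mat_0_mult_vec[OF A])
  then have "inverse c \<cdot>\<^sub>v (c \<cdot>\<^sub>v v) = 0\<^sub>v n"
    by (auto intro: eq_vecI)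
  then show ?case
    using 0 c(2) by (simp add: smult_smult_assoc)
next
  case (Suc d)
  then obtain \<gamma> where "poly g \<gamma> = 0"
    using alg_closed_imp_poly_has_root by (metis zero_less_Suc)
  then obtain h where g: "g = h * [:- \<gamma>, 1:]"
    by (metis dvdE mult.commute poly_eq_0_iff_dvd)
  define w where "w = poly_mat [:- \<gamma>, 1:] A *\<^sub>v v"
  have w: "w \<in> carrier_vec n"
    unfolding w_def using A Suc.prems by (intro mult_mat_vec_carrier[of _ n n] poly_mat_carrier) auto
  show ?case
  proof (cases "w = 0\<^sub>v n")
    case True
    have Av: "A *\<^sub>v v \<in> carrier_vec n"
      using mult_mat_vec_carrier[OF A] Suc.prems by blast
    have "- \<gamma> \<cdot>\<^sub>v v + A *\<^sub>v v = w"
      using Suc.prems Av mult_mat_vec_carrier[OF A Av]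
      by (simp add: w_def poly_mat_pCons_mult_vec[OF A] poly_mat_0_mult_vec[OF A])
    then have zero: "vec_index (- \<gamma> \<cdot>\<^sub>v v + A *\<^sub>v v) i = 0" if "i < n" for i
      using True that by simp
    have "A *\<^sub>v v = \<gamma> \<cdot>\<^sub>v v"
    proof (rule eq_vecI)
      fix i assume "i < dim_vec (\<gamma> \<cdot>\<^sub>v v)"
      then show "vec_index (A *\<^sub>v v) i = vec_index (\<gamma> \<cdot>\<^sub>v v) i"
        using zero[of i] A Suc.prems by (simp del: index_mult_mat_vec)
    qed (use A Suc.prems in auto)
    then show ?thesis
      using \<open>poly g \<gamma> = 0\<close> A Suc.prems by (auto simp: eigenvalue_def eigenvector_def)
  next
    case False
    have "poly_mat h A *\<^sub>v w = 0\<^sub>v n"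
      using A Suc.prems assoc_mult_mat_vec[of "poly_mat h A" n n "poly_mat [:- \<gamma>, 1:] A" n v]
      by (simp add: w_def g poly_mat_mult[OF A] del: mult_pCons_right)
    moreover have "h \<noteq> 0"
      using Suc.prems by (auto simp: g)
    moreover from this have "d = degree h"
      using Suc.hyps(2) by (simp add: g degree_mult_eq del: mult_pCons_right)
    ultimately obtain \<delta> where "poly h \<delta> = 0" "eigenvalue A \<delta>"
      using Suc.hyps(1) w False by blast
    then show ?thesis
      by (auto simp: g)
  qed
qed

text \<open>Spectral mapping: an eigenvector of \<open>f(A)\<close> for \<beta> lies in the kernel
  of the polynomial \<open>f\<close> minus \<beta> taken at \<open>A\<close>.\<close>

lemma eigenvalue_poly_mat:
  fixes A :: "'a::alg_closed_field mat"
  assumes A: "A \<in> carrier_mat n n"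
  shows "eigenvalue (poly_mat f A) \<beta> \<longleftrightarrow> (\<exists>\<gamma>. eigenvalue A \<gamma> \<and> poly f \<gamma> = \<beta>)"
proof
  assume "\<exists>\<gamma>. eigenvalue A \<gamma> \<and> poly f \<gamma> = \<beta>"
  then show "eigenvalue (poly_mat f A) \<beta>"
    using A eigenvector_poly_mat[OF A] unfolding eigenvalue_def eigenvector_def by auto
next
  assume ev: "eigenvalue (poly_mat f A) \<beta>"
  have n: "n > 0"
    using eigenvalue_imp_nonzero_dim[OF _ ev] A by auto
  obtain v where v: "v \<in> carrier_vec n" "v \<noteq> 0\<^sub>v n" "poly_mat f A *\<^sub>v v = \<beta> \<cdot>\<^sub>v v"
    using ev A unfolding eigenvalue_def eigenvector_def by auto
  show "\<exists>\<gamma>. eigenvalue A \<gamma> \<and> poly f \<gamma> = \<beta>"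
  proof (cases "f = [:\<beta>:]")
    \<comment> \<open>Here \<open>f\<close> minus \<beta> is zero and the kernel argument says
      nothing, but any eigenvalue of \<open>A\<close> will do, and one exists because
      \<open>n > 0\<close>.\<close>
    case True
    obtain \<gamma> where "poly (char_poly A) \<gamma> = 0"
      using alg_closed_imp_poly_has_root[of "char_poly A"] degree_monic_char_poly[OF A] n by auto
    then show ?thesis
      using True eigenvalue_root_char_poly[OF A] by auto
  next
    case False
    have Av: "A *\<^sub>v v \<in> carrier_vec n"
      using mult_mat_vec_carrier[OF A v(1)] .
    have "poly_mat (f + [:- \<beta>:]) A *\<^sub>v v = \<beta> \<cdot>\<^sub>v v + poly_mat [:- \<beta>:] A *\<^sub>v v"
      using A v by (simp add: poly_mat_add[OF A] add_mult_distrib_mat_vec[of _ n n])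
    also have "\<dots> = 0\<^sub>v n"
      using v by (auto simp: poly_mat_pCons_mult_vec[OF A] poly_mat_0_mult_vec[OF A Av])
    finally have "poly_mat (f + [:- \<beta>:]) A *\<^sub>v v = 0\<^sub>v n" .
    moreover have "f + [:- \<beta>:] \<noteq> 0"
      using False by (simp flip: eq_neg_iff_add_eq_0)
    ultimately show ?thesis
      using poly_mat_kernel_imp_eigenvalue[OF A _ v(1,2), of "f + [:- \<beta>:]"] by auto
  qed
qed

section \<open>Integral closedness of \<open>K[X]\<close>\<close>

text \<open>A nonconstant divisor of least degree is irreducible, hence prime.\<close>

lemma exists_prime_poly_dvd:
  fixes b :: "'a::field poly"
  assumes "degree b > 0"
  shows "\<exists>p. prime_elem p \<and> p dvd b"
proof -
  have "b dvd b \<and> degree b > 0"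
    using assms by simp
  from ex_has_least_nat[of "\<lambda>p. p dvd b \<and> degree p > 0", OF this, of degree]
  obtain p where p: "p dvd b" "degree p > 0"
    and least: "\<And>q. q dvd b \<Longrightarrow> degree q > 0 \<Longrightarrow> degree p \<le> degree q"
    by (elim exE conjE) simp
  have "irreducible p"
  proof (rule irreducibleI)
    show "p \<noteq> 0" "\<not> p dvd 1"
      using p(2) by (auto simp: is_unit_iff_degree)
    fix u w assume uw: "p = u * w"
    then have nz: "u \<noteq> 0" "w \<noteq> 0"
      using p(2) by auto
    have "degree p = degree u + degree w"
      using nz by (simp add: uw degree_mult_eq)
    moreover have "u dvd b"
      using p(1) dvd_mult_left[of u w b] by (simp add: uw)
    ultimately have "degree u = 0 \<or> degree w = 0"
      using least[of u] by (cases "degree u = 0") auto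
    then show "u dvd 1 \<or> w dvd 1"
      using nz by (simp add: is_unit_iff_degree)
  qed
  from field_poly_irreducible_imp_prime[OF this] p(1) show ?thesis
    by (intro exI[of _ p] conjI)
qed

text \<open>The rational root argument: a prime factor of the denominator would divide the numerator
  too, and cancelling it contradicts the choice of a denominator of least degree.\<close>

lemma integral_over_polys_imp_poly:
  fixes x :: "'a::field poly fract"
  assumes "integral_over (range to_fract) x"
  shows "x \<in> range to_fract"
proof -
  obtain P where P: "P \<in> monic_polys_over (range to_fract)" "poly P x = 0"
    using assms unfolding integral_over_def by (elim bexE)
  have monic: "lead_coeff P = 1 \<and> (\<forall>i. coeff P i \<in> range to_fract)"
    using P(1) unfolding monic_polys_over_def mem_Collect_eq .
  then have "\<exists>y. coeff P i = to_fract y" for i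
    by (elim conjE allE imageE) (rule exI)
  then obtain c where c: "\<And>i. coeff P i = to_fract (c i)"
    by metis
  define m where "m = degree P"
  have "to_fract (c m) = to_fract 1"
    using conjunct1[OF monic] c[of m] unfolding m_def to_fract_1 by (rule trans[OF sym, rotated])
  then have cm: "c m = 1"
    unfolding to_fract_eq_iff .
  \<comment> \<open>A denominator of least degree takes the place of a fraction in lowest
    terms.\<close>
  define denom where "denom b \<longleftrightarrow> b \<noteq> 0 \<and> to_fract b * x \<in> range to_fract" for b
  have "\<exists>b. denom b"
  proof (cases x)
    case (Fract a b)
    then show ?thesis
      by (auto simp: denom_def Fract_conv_to_fract intro!: exI[of _ b])
  qed
  then obtain b where b: "denom b" and least: "\<And>q. denom q \<Longrightarrow> degree b \<le> degree q"
    using ex_has_least_nat[of denom _ degree] by (elim exE) metis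
  obtain a where a: "to_fract b * x = to_fract a"
    using b unfolding denom_def by auto
  \<comment> \<open>The integral equation of \<open>x\<close>, multiplied by \<open>b ^ m\<close> to
    clear denominators.\<close>
  have "(\<Sum>i\<le>m. c i * a ^ i * b ^ (m - i)) = 0"
  proof -
    have "to_fract (\<Sum>i\<le>m. c i * a ^ i * b ^ (m - i)) = to_fract b ^ m * poly P x"
      unfolding poly_altdef sum_distrib_left m_def[symmetric] to_fract_sum
    proof (intro sum.cong refl)
      fix i assume "i \<in> {..m}"
      then have "to_fract b ^ m = to_fract b ^ i * to_fract b ^ (m - i)"
        by (simp flip: power_add)
      moreover have pow: "to_fract (q ^ k) = to_fract q ^ k" for q :: "'a poly" and k
        by (induction k) auto
      ultimately show "to_fract (c i * a ^ i * b ^ (m - i)) = to_fract b ^ m * (coeff P i * x ^ i)"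
        by (simp add: c pow power_mult_distrib flip: a)
    qed
    then show ?thesis
      unfolding P(2) mult_zero_right to_fract_eq_0_iff .
  qed
  then have "a ^ m = - (\<Sum>i<m. c i * a ^ i * b ^ (m - i))"
    by (simp add: lessThan_Suc_atMost[symmetric] cm add_eq_0_iff)
  \<comment> \<open>Below the top index the exponent of \<open>b\<close> is positive.\<close>
  moreover have "b dvd c i * a ^ i * b ^ (m - i)" if "i < m" for i
    using that by (intro dvd_mult dvd_power) auto
  ultimately have b_dvd: "b dvd a ^ m"
    by (simp only: dvd_minus_iff) (rule dvd_sum, simp)
  show ?thesis
  proof (cases "degree b = 0")
    case True
    then obtain k where k: "b = [:k:]"
      by (rule degree_eq_zeroE)
    with b have "k \<noteq> 0"
      by (auto simp: denom_def)
    then have "to_fract b * to_fract (smult (inverse k) a) = to_fract a"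
      unfolding to_fract_mult[symmetric] by (simp add: k)
    with a have "to_fract b * x = to_fract b * to_fract (smult (inverse k) a)"
      by (simp only:)
    then have "x = to_fract (smult (inverse k) a)"
      using b unfolding denom_def by (subst (asm) mult_left_cancel) auto
    then show ?thesis
      by blast
  next
    case False
    then obtain p where p: "prime_elem p" "p dvd b"
      using exists_prime_poly_dvd by blast
    then have "p dvd a"
      using b_dvd prime_elem_dvd_power dvd_trans by blast
    then obtain a' where a': "a = p * a'" ..
    from p(2) obtain b' where b': "b = p * b'" ..
    have "to_fract p * (to_fract b' * x) = to_fract p * to_fract a'"
      using a by (simp add: a' b' mult.assoc)
    then have "to_fract b' * x = to_fract a'"
      using p(1) by (auto dest: prime_elem_not_zeroI)
    then have "denom b'"
      using b by (auto simp: denom_def b')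
    moreover have "degree b' < degree b"
    proof -
      have "degree p \<noteq> 0"
        using p(1) is_unit_iff_degree[of p] by (auto simp: prime_elem_def)
      then show ?thesis
        using b by (auto simp: denom_def b' degree_mult_eq)
    qed
    ultimately show ?thesis
      using least by force
  qed
qed

section \<open>Integral-valued polynomials\<close>

interpretation to_ac: field_hom to_ac
  by unfold_locales auto

interpretation to_ac_poly: map_poly_comm_ring_hom to_ac ..

text \<open>The leading coefficient 1 is mapped to 1, so the degree cannot drop even if
  \<open>h\<close> is not injective.\<close>

lemma monic_polys_over_hom:
  assumes "comm_ring_hom h" and "p \<in> monic_polys_over R"
  shows "map_poly h p \<in> monic_polys_over (h ` R)"
proof -
  interpret comm_ring_hom h by fact
  have p: "lead_coeff p = 1" "\<forall>i. coeff p i \<in> R"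
    using assms(2) by (auto simp: monic_polys_over_def)
  then have "coeff (map_poly h p) (degree p) = 1"
    by simp
  then have "degree (map_poly h p) = degree p"
    by (intro antisym degree_map_poly_le le_degree) simp
  then show "map_poly h p \<in> monic_polys_over (h ` R)"
    using p by (simp add: monic_polys_over_def)
qed

lemma integral_over_hom:
  assumes "comm_ring_hom h" and "integral_over R x"
  shows "integral_over (h ` R) (h x)"
proof -
  interpret comm_ring_hom h by fact
  obtain p where p: "p \<in> monic_polys_over R" "poly p x = 0"
    using assms(2) unfolding integral_over_def by blast
  have "poly (map_poly h p) (h x) = 0"
    by (simp add: p(2))
  then show ?thesis
    using monic_polys_over_hom[OF assms(1) p(1)] unfolding integral_over_def by (rule bexI)
qed

text \<open>The coefficients of an integral equation are pulled back along the inverse of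
  \<open>h\<close>, and injectivity makes the pulled-back value zero.\<close>

lemma integral_over_inj_hom:
  assumes "inj_comm_ring_hom h" and "integral_over (h ` R) (h x)"
  shows "integral_over R x"
proof -
  interpret inj_comm_ring_hom h by fact
  obtain q where q: "lead_coeff q = 1" "\<And>i. coeff q i \<in> h ` R" "poly q (h x) = 0"
    using assms(2) unfolding integral_over_def monic_polys_over_def by blast
  have inv_h: "the_inv h (h y) = y" for y
    by (rule the_inv_f_f) (rule inj_f)
  define p where "p = map_poly (the_inv h) q"
  have "coeff p i = the_inv h (coeff q i)" for i
    unfolding p_def using inv_h[of 0] by (intro coeff_map_poly) simp
  then have coeff_p: "coeff q i = h (coeff p i)" "coeff p i \<in> R" for i
    using q(2)[of i] inv_h by auto
  then have q_eq: "q = map_poly h p"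
    by (intro poly_eqI) simp
  then have "degree q = degree p"
    by simp
  with q(1) coeff_p have "p \<in> monic_polys_over R"
    by (simp add: monic_polys_over_def)
  moreover have "poly p x = 0"
    using q(3) by (simp add: q_eq)
  ultimately show ?thesis
    unfolding integral_over_def by blast
qed

text \<open>The way back from the algebraic closure: integrality descends to \<open>K\<close>, which
  is the quotient field of \<open>D\<close>, and \<open>D\<close> is closed there.\<close>

lemma mem_of_integral_over_to_ac:
  assumes D: "integrally_closed_domain D" "quotient_field D = UNIV"
    and "integral_over (to_ac ` D) (to_ac c)"
  shows "c \<in> D"
proof -
  have "integral_over D c"
    using integral_over_inj_hom[OF to_ac.inj_comm_ring_hom_axioms] assms(3) .
  then show ?thesis
    using D unfolding integrally_closed_domain_def by simp
qed

text \<open>The characteristic polynomial splits over the algebraic closure. Its roots are the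
  eigenvalues, and its coefficients lie in any ring containing them, here the integral closure of
  \<open>D\<close>.\<close>

lemma char_poly_over_integrally_closed:
  fixes N :: "'k::field mat"
  assumes D: "integrally_closed_domain D" "quotient_field D = UNIV"
    and N: "N \<in> carrier_mat n n"
    and ev: "\<And>\<beta>. eigenvalue (map_mat to_ac N) \<beta> \<Longrightarrow> integral_over (to_ac ` D) \<beta>"
  shows "char_poly N \<in> monic_polys_over D"
proof -
  let ?I = "{x. integral_over (to_ac ` D) x}"
  let ?P = "char_poly (map_mat to_ac N)"
  have I: "is_subring ?I"
    using D(1) by (intro is_subring_integral_closure is_subring_hom_image)
      (auto simp: integrally_closed_domain_def intro: to_ac.comm_ring_hom_axioms)
  have N': "map_mat to_ac N \<in> carrier_mat n n"
    using N by simp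
  have lc: "lead_coeff ?P = 1"
    using degree_monic_char_poly[OF N'] by simp
  then obtain B where B: "?P = (\<Prod>x\<in>#B. [:- x, 1:])"
    using alg_closed_imp_factorization[of ?P] by force
  have roots: "x \<in> ?I" if "x \<in># B" for x
  proof -
    have "poly ?P x = 0"
      using that by (auto simp: B poly_prod_mset prod_mset_zero_iff)
    then show ?thesis
      using ev eigenvalue_root_char_poly[OF N'] by simp
  qed
  \<comment> \<open>Stated for an arbitrary multiset of integral roots, to allow induction.\<close>
  have "(\<Prod>x\<in>#B'. [:- x, 1:]) \<in> {p. \<forall>i. coeff p i \<in> ?I}" if "\<forall>x\<in>#B'. x \<in> ?I" for B'
    using that
  proof (induction B')
    case empty
    then show ?case using is_subring_one[OF is_subring_polys[OF I]] by simp
  next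
    case (add x B')
    have "[:- x, 1:] \<in> {p. \<forall>i. coeff p i \<in> ?I}"
      using add.prems is_subring_zero[OF I] is_subring_one[OF I] is_subring_uminus[OF I, of x]
      by (auto simp: coeff_pCons split: nat.splits)
    moreover have "(\<Prod>x\<in>#B'. [:- x, 1:]) \<in> {p. \<forall>i. coeff p i \<in> ?I}"
      using add by simp
    ultimately show ?case
      unfolding image_mset_add_mset prod_mset.add_mset
      by (rule is_subring_mult[OF is_subring_polys[OF I]])
  qed
  then have "coeff ?P i \<in> ?I" for i
    using roots unfolding B by blast
  then have "coeff (char_poly N) i \<in> D" for i
    using mem_of_integral_over_to_ac[OF D] by (simp add: to_ac.char_poly_hom[OF N])
  then show ?thesis
    using degree_monic_char_poly[OF N] by (simp add: monic_polys_over_def)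
qed

section \<open>Integrality of matrices and of their eigenvalues\<close>

lemma eigenvalue_map_poly_mat:
  assumes "M \<in> carrier_mat n n"
  shows "eigenvalue (map_mat to_ac (poly_mat f M)) \<beta> \<longleftrightarrow>
    (\<exists>\<alpha>\<in>Omega_mat M. poly (map_poly to_ac f) \<alpha> = \<beta>)"
  using eigenvalue_poly_mat[of "map_mat to_ac M" n] assms
  by (auto simp: to_ac.map_mat_poly_mat[OF assms] Omega_mat_def)

text \<open>If \<open>p\<close> annihilates \<open>N\<close>, then by spectral mapping the value of
  \<open>p\<close> at \<beta> is an eigenvalue of the zero matrix.\<close>

lemma eigenvalue_integral_of_mat_integral:
  assumes N: "N \<in> carrier_mat n n" and "mat_integral_over D N"
    and \<beta>: "eigenvalue (map_mat to_ac N) \<beta>"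
  shows "integral_over (to_ac ` D) \<beta>"
proof -
  obtain p where p: "p \<in> monic_polys_over D" "poly_mat p N = 0\<^sub>m n n"
    using assms(1,2) unfolding mat_integral_over_def by auto
  have "eigenvalue (map_mat to_ac (poly_mat p N)) (poly (map_poly to_ac p) \<beta>)"
    using eigenvalue_map_poly_mat[OF N] \<beta> by (auto simp: Omega_mat_def)
  moreover have "map_mat to_ac (poly_mat p N) = 0\<^sub>m n n"
    unfolding p(2) by (intro eq_matI) auto
  ultimately obtain v where v: "v \<in> carrier_vec n" "v \<noteq> 0\<^sub>v n"
    "0\<^sub>m n n *\<^sub>v v = poly (map_poly to_ac p) \<beta> \<cdot>\<^sub>v v"
    by (auto simp: eigenvalue_def eigenvector_def)
  have "poly (map_poly to_ac p) \<beta> = 0"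
  proof (rule ccontr)
    assume nz: "poly (map_poly to_ac p) \<beta> \<noteq> 0"
    have "vec_index v i = 0" if "i < n" for i
      using arg_cong[OF v(3), of "\<lambda>v. vec_index v i"] that v(1) nz by simp
    then have "v = 0\<^sub>v n"
      using v(1) by (intro eq_vecI) auto
    with v(2) show False ..
  qed
  then show ?thesis
    using monic_polys_over_hom[OF to_ac.comm_ring_hom_axioms p(1)]
    unfolding integral_over_def by blast
qed

text \<open>The condition is checked for each \<open>M\<close> separately. Membership in
  \<open>K[S]\<close> is automatic for a polynomial in \<open>M\<close>, so only integrality of
  \<open>f(M)\<close> is at stake.\<close>

lemma Int_mat_iff_integral_on_Omega:
  assumes D: "integrally_closed_domain D" "quotient_field D = UNIV"
    and S: "S \<subseteq> carrier_mat n n"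
  shows "f \<in> Int_mat S (integral_elements D n S) \<longleftrightarrow>
    (\<forall>\<alpha>\<in>Omega S. integral_over (to_ac ` D) (poly (map_poly to_ac f) \<alpha>))"
proof -
  have "poly_mat f M \<in> integral_elements D n S \<longleftrightarrow>
      (\<forall>\<alpha>\<in>Omega_mat M. integral_over (to_ac ` D) (poly (map_poly to_ac f) \<alpha>))" if "M \<in> S" for M
  proof
    have M: "M \<in> carrier_mat n n"
      using S that by blast
    then have fM: "poly_mat f M \<in> carrier_mat n n"
      by simp
    {
      assume "poly_mat f M \<in> integral_elements D n S"
      then show "\<forall>\<alpha>\<in>Omega_mat M. integral_over (to_ac ` D) (poly (map_poly to_ac f) \<alpha>)"
        using eigenvalue_integral_of_mat_integral[OF fM] eigenvalue_map_poly_mat[OF M]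
        unfolding integral_elements_def by blast
    next
      assume "\<forall>\<alpha>\<in>Omega_mat M. integral_over (to_ac ` D) (poly (map_poly to_ac f) \<alpha>)"
      then have "char_poly (poly_mat f M) \<in> monic_polys_over D"
        by (intro char_poly_over_integrally_closed[OF D fM])
          (auto simp: eigenvalue_map_poly_mat[OF M])
      then have "mat_integral_over D (poly_mat f M)"
        using cayley_hamilton[OF fM] M unfolding mat_integral_over_def by auto
      moreover have "poly_mat f M \<in> gen_algebra n S"
        using that by (intro poly_mat_gen_algebra[OF M] gen_algebra.gen)
      ultimately show "poly_mat f M \<in> integral_elements D n S"
        unfolding integral_elements_def by blast
    }
  qed
  then show ?thesis
    unfolding Int_mat_def Omega_def by blast
qed

text \<open>An integral equation alone does not control the degree; degree exactly \<open>n\<close>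
  comes from the characteristic polynomial of \<open>f(M)\<close>, which has the value as a
  root.\<close>

lemma Int_ac_iff_integral_on_Omega:
  assumes D: "integrally_closed_domain D" "quotient_field D = UNIV"
    and S: "S \<subseteq> carrier_mat n n"
  shows "f \<in> Int_ac (Omega S) (Lambda D n) \<longleftrightarrow>
    (\<forall>\<alpha>\<in>Omega S. integral_over (to_ac ` D) (poly (map_poly to_ac f) \<alpha>))"
proof
  assume "f \<in> Int_ac (Omega S) (Lambda D n)"
  then show "\<forall>\<alpha>\<in>Omega S. integral_over (to_ac ` D) (poly (map_poly to_ac f) \<alpha>)"
    using monic_polys_over_hom[OF to_ac.comm_ring_hom_axioms]
    unfolding Int_ac_def Lambda_def integral_over_def by blast
next
  assume int: "\<forall>\<alpha>\<in>Omega S. integral_over (to_ac ` D) (poly (map_poly to_ac f) \<alpha>)"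
  have "poly (map_poly to_ac f) \<alpha> \<in> Lambda D n" if "M \<in> S" "\<alpha> \<in> Omega_mat M" for M \<alpha>
  proof -
    have M: "M \<in> carrier_mat n n"
      using S that(1) by blast
    then have fM: "poly_mat f M \<in> carrier_mat n n"
      by simp
    have "char_poly (poly_mat f M) \<in> monic_polys_over D"
      using int that(1)
      by (intro char_poly_over_integrally_closed[OF D fM])
        (auto simp: eigenvalue_map_poly_mat[OF M] Omega_def)
    moreover have "eigenvalue (map_mat to_ac (poly_mat f M)) (poly (map_poly to_ac f) \<alpha>)"
      using eigenvalue_map_poly_mat[OF M] that(2) by blast
    then have "poly (map_poly to_ac (char_poly (poly_mat f M))) (poly (map_poly to_ac f) \<alpha>) = 0"
      using fM eigenvalue_root_char_poly[of "map_mat to_ac (poly_mat f M)" n]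
      by (simp add: to_ac.char_poly_hom[OF fM])
    ultimately show ?thesis
      using degree_monic_char_poly[OF fM] unfolding Lambda_def by blast
  qed
  then show "f \<in> Int_ac (Omega S) (Lambda D n)"
    unfolding Int_ac_def Omega_def by blast
qed

text \<open>The embedding \<open>to_fract\<close> into \<open>K(X)\<close> supplies a field in which
  the quotient field of \<open>R\<close> can be formed.\<close>

lemma integrally_closed_polys_integral_valued:
  fixes D :: "'k::field set" and E :: "'k alg_closure set"
  assumes D: "is_subring D"
  defines "R \<equiv> {f. \<forall>\<alpha>\<in>E. integral_over (to_ac ` D) (poly (map_poly to_ac f) \<alpha>)}"
  shows "integrally_closed_domain (to_fract ` R)"
proof -
  have D': "is_subring (to_ac ` D)"
    by (rule is_subring_hom_image[OF to_ac.comm_ring_hom_axioms D])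
  let ?I = "{x. integral_over (to_ac ` D) x}"
  have I: "is_subring ?I"
    by (rule is_subring_integral_closure[OF D'])
  have to_fract_hom: "inj_comm_ring_hom (to_fract :: 'k poly \<Rightarrow> _)"
    by unfold_locales auto
  have "is_subring R"
    unfolding R_def is_subring_def[of "Collect _"]
    using is_subring_one[OF I]
    by (auto simp: to_ac_poly.hom_minus to_ac_poly.hom_mult
        intro: is_subring_diff[OF I, simplified] is_subring_mult[OF I, simplified])
  then have "is_subring (to_fract ` R)"
    using to_fract_hom inj_comm_ring_hom.axioms(1) by (intro is_subring_hom_image)
  \<comment> \<open>Shown for all integral elements of \<open>K(X)\<close>, in particular for those
    in the quotient field of the ring.\<close>
  moreover have "x \<in> to_fract ` R" if x: "integral_over (to_fract ` R) x" for x
  proof -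
    obtain g where g: "x = to_fract g"
      using integral_over_polys_imp_poly integral_over_mono[OF _ x] by blast
    then have gR: "integral_over R g"
      using x integral_over_inj_hom[OF to_fract_hom] by blast
    have "integral_over (to_ac ` D) (poly (map_poly to_ac g) \<alpha>)" if "\<alpha> \<in> E" for \<alpha>
    proof -
      let ?ev = "\<lambda>f. poly (map_poly to_ac f) \<alpha>"
      have "comm_ring_hom ?ev"
        by unfold_locales (simp_all add: to_ac_poly.hom_add to_ac_poly.hom_mult)
      \<comment> \<open>Evaluation at \<alpha> maps \<open>R\<close> into \<open>?I\<close>, so it
        turns the equation of \<open>g\<close> over \<open>R\<close> into one of its value over
        \<open>?I\<close>.\<close>
      from integral_over_hom[OF this gR] have "integral_over ?I (?ev g)"
        using that by (elim integral_over_mono[rotated]) (auto simp: R_def)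
      then show ?thesis
        by (rule integral_over_trans[OF D'])
    qed
    then show ?thesis
      unfolding g R_def by blast
  qed
  ultimately show ?thesis
    by (simp add: integrally_closed_domain_def)
qed

theorem theorem2p9:
  fixes D :: "'k::field set" and n :: nat and S :: "'k mat set"
  assumes "integrally_closed_domain D"
    and "quotient_field D = UNIV"
    and "n \<ge> 1"
    and "S \<subseteq> carrier_mat n n"
  shows "Int_mat S (integral_elements D n S) = Int_ac (Omega S) (Lambda D n) \<and>
    integrally_closed_domain (to_fract ` Int_mat S (integral_elements D n S))"
proof
  have D: "is_subring D"
    using assms(1) unfolding integrally_closed_domain_def by blast
  show "Int_mat S (integral_elements D n S) = Int_ac (Omega S) (Lambda D n)"
    by (intro Set.set_eqI) (simp only: Int_mat_iff_integral_on_Omega[OF assms(1,2,4)]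
      Int_ac_iff_integral_on_Omega[OF assms(1,2,4)])
  have "Int_mat S (integral_elements D n S) =
      {f. \<forall>\<alpha>\<in>Omega S. integral_over (to_ac ` D) (poly (map_poly to_ac f) \<alpha>)}"
    by (intro Set.set_eqI) (simp only: Int_mat_iff_integral_on_Omega[OF assms(1,2,4)] mem_Collect_eq)
  then show "integrally_closed_domain (to_fract ` Int_mat S (integral_elements D n S))"
    using integrally_closed_polys_integral_valued[OF D, of "Omega S"] by (simp only:)
qed

end
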